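(* Let $\mathcal{X}\subset\mathbb{R}^d$ be convex, let $w_*\in\mathbb{R}^d$ with $\|w_*\|_2=1$, let $\delta>0$, and let $\mathcal{G}=(\mathcal{X},E)$ be a nearest-neighbor graph such that for all $x,x'\in\mathcal{X}$, if $\|x-x'\|_2\le\delta$ then $(x,x')\in E$. Let $\epsilon>0$. Let $\mathcal{S}_1\subset\mathcal{X}\times\{-1,1\}$ be the seed labeled examples, and let $x_{1,0},\ldots,x_{d-1,0}$ denote the seed points. For $i\in[d-1]$ define $$\gamma_i=\mathrm{dist}\bigl(x_{i,0},\mathrm{conv}(\mathcal{S}_1^{-y_{x_{i,0}}})\bigr),$$ $$\mathcal{Z}_i=\{z\in\mathbb{R}^d:\ \|z-x_{i,0}\|\le\gamma_i+2\delta+\epsilon\ \text{ and }\ \mathrm{dist}(z,\{x\in\mathbb{R}^d:x^\top w_*=0\})\le\epsilon\},$$ and let $$\sigma=\min_{z_i\in\mathcal{Z}_i\ \forall i\in[d-1]}\sigma_{d-1}([z_1\ \cdots\ z_{d-1}]),$$ where $\sigma_{d-1}(\cdot)$ denotes the $(d-1)$th singular value of the matrix $[z_1\ \cdots\ z_{d-1}]$. Assume $\sigma>0$. Then, after the Modified SEALS algorithm (described in the context) makes $$\max_{i\in[d-1]} d\left(\frac{\gamma_i}{\delta}+2\log\left(\frac{2d\delta}{\epsilon\min(\sigma,1)}\right)\right)$$ queries, its estimate $\widehat{w}_r$ satisfies $\|\widehat{w}_r-w_*\|\le\epsilon$.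
   Context: Notation: $[d-1]=\{1,\dots,d-1\}$; $\|\cdot\|$ is the Euclidean norm; $\mathrm{dist}$ is Euclidean distance from a point to a set; $\mathrm{conv}$ is the convex hull. Labels: each $x\in\mathcal{X}$ has label $y_x=1$ if $w_*^\top x\ge 0$ and $y_x=-1$ if $w_*^\top x<0$. The algorithm can query any point of $\mathcal{X}$; a query of $x$ reveals $y_x$. Labeled data: $\mathcal{S}_r\subset\mathcal{X}\times\{-1,1\}$ consists of the examples and their labels queried until round $r$ ($\mathcal{S}_1$ being the seed labeled examples, which include the $d-1$ seed points with their labels and possibly further labeled points); $\mathcal{S}_r^{1}=\{x:(x,1)\in\mathcal{S}_r\}$ and $\mathcal{S}_r^{-1}=\{x:(x,-1)\in\mathcal{S}_r\}$. MaxMarginSeparator$(A,B)$: finds a maximum-margin separator of $A$ and $B$ (a support vector machine) and returns the separating hyperplane $H$ and the margin $\gamma$. Modified SEALS algorithm: initialize $C_{i,1}=\{x_{i,0}\}$ for $i\in[d-1]$. For rounds $r=1,2,\ldots$: (1) For each $i=1,\dots,d-1$: compute $(H_{x,r},\gamma_{x,r})=\text{MaxMarginSeparator}(\mathcal{S}_r^{-y_x},x)$ for all $x\in C_{i,r}$; let $\bar{x}_{i,r}\in\arg\min_{x\in C_{i,r}}\gamma_{x,r}$ and $\tilde{x}_{i,r}\in\arg\min_{x':(\bar{x}_{i,r},x')\in E}\mathrm{dist}(x',H_{\bar{x}_{i,r},r})$ (the latter set may contain several examples if $\mathrm{dist}(\bar{x}_{i,r},H_{\bar{x}_{i,r},r})\le\delta$;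 in this case ties are broken by letting $\tilde{x}_{i,r}$ be the projection of $\bar{x}_{i,r}$ onto $H_{\bar{x}_{i,r},r}$); query $\tilde{x}_{i,r}$; set $C_{i,r+1}=C_{i,r}\cup\{\tilde{x}_{i,r}\}$. (2) Set $\mathcal{S}_{r+1}=\mathcal{S}_r\cup\{(\tilde{x}_{i,r},y_{\tilde{x}_{i,r}}):i\in[d-1]\}$. (3) Fit a homogeneous max-margin separator (hyperplane through the origin) with normal vector $\widehat{w}_{r+1}$ to $\mathcal{S}_{r+1}$.
   Formalization: The graph's edges are taken to be exactly the pairs in X at distance at most δ (with longer edges the claim can fail); each seed point has an oppositely labeled example in S_1, and at least d-1 queries are made so that an estimate exists. *)

theory Defs
  imports "HOL-Analysis.Analysis"
begin

subsection \<open>Singular values\<close>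

text \<open>
  \<open>singular_value k A\<close> is the \<open>k\<close>-th largest singular value of \<open>A\<close> (counting from \<open>k = 1\<close>), where
  the singular values are the nonnegative square roots of the eigenvalues of \<open>A\<^sup>T A\<close>, repeated
  according to multiplicity. It is meaningful for \<open>k\<close> from 1 to the smaller of the numbers of rows
  and columns. As \<open>A\<^sup>T A\<close> is symmetric, multiplicity is the dimension of the eigenspace.
\<close>

definition singular_space :: "real^'m^'n \<Rightarrow> real \<Rightarrow> (real^'m) set" where
  "singular_space A s = {v. (transpose A ** A) *v v = s\<^sup>2 *\<^sub>R v}"

definition singular_values :: "real^'m^'n \<Rightarrow> real set" where
  "singular_values A = {s. 0 \<le> s \<and> (\<exists>v\<in>singular_space A s. v \<noteq> 0)}"

definition singular_value :: "nat \<Rightarrow> real^'m^'n \<Rightarrow> real" where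
  "singular_value k A =
     Max {s \<in> singular_values A.
            k \<le> (\<Sum>t\<in>{t \<in> singular_values A. s \<le> t}. dim (singular_space A t))}"

definition matrix_of_columns :: "('m \<Rightarrow> real^'n) \<Rightarrow> real^'m^'n" where
  "matrix_of_columns z = (\<chi> j i. z i $ j)"


subsection \<open>Labels and maximum-margin separators\<close>

definition label :: "'a::real_inner \<Rightarrow> 'a \<Rightarrow> int" where
  "label w x = (if 0 \<le> w \<bullet> x then 1 else - 1)"

definition with_label :: "('a \<times> int) set \<Rightarrow> int \<Rightarrow> 'a set" where
  "with_label S y = {x. (x, y) \<in> S}"

definition separating_hyperplane :: "'a::euclidean_space set \<Rightarrow> 'a set \<Rightarrow> 'a set \<Rightarrow> bool" where
  "separating_hyperplane A B H \<longleftrightarrow>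
     (\<exists>a b. a \<noteq> 0 \<and> H = {z. a \<bullet> z = b} \<and> (\<forall>x\<in>A. a \<bullet> x \<le> b) \<and> (\<forall>x\<in>B. b \<le> a \<bullet> x))"

definition margin :: "'a::euclidean_space set \<Rightarrow> 'a set \<Rightarrow> 'a set \<Rightarrow> real" where
  "margin A B H = setdist (A \<union> B) H"

definition max_margin_separator ::
    "'a::euclidean_space set \<Rightarrow> 'a set \<Rightarrow> 'a set \<Rightarrow> real \<Rightarrow> bool" where
  "max_margin_separator A B H g \<longleftrightarrow>
     separating_hyperplane A B H \<and> g = margin A B H \<and>
     (\<forall>H'. separating_hyperplane A B H' \<longrightarrow> margin A B H' \<le> g)"

text \<open>
  Homogeneous separators are represented by their unit normal, pointing to the side of the label 1.
  Separation is not strict: examples labelled 1 may lie on the hyperplane (the origin always does),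
  in which case the maximal margin can be 0.
\<close>

definition homogeneous_separator :: "('a::euclidean_space \<times> int) set \<Rightarrow> 'a \<Rightarrow> bool" where
  "homogeneous_separator S u \<longleftrightarrow>
     norm u = 1 \<and> (\<forall>x\<in>with_label S 1. 0 \<le> u \<bullet> x) \<and> (\<forall>x\<in>with_label S (- 1). u \<bullet> x \<le> 0)"

definition homogeneous_margin :: "('a::euclidean_space \<times> int) set \<Rightarrow> 'a \<Rightarrow> real" where
  "homogeneous_margin S u = margin (with_label S 1) (with_label S (- 1)) {z. u \<bullet> z = 0}"

definition homogeneous_max_margin :: "('a::euclidean_space \<times> int) set \<Rightarrow> 'a \<Rightarrow> bool" where
  "homogeneous_max_margin S u \<longleftrightarrow>
     is_arg_max (homogeneous_margin S) (homogeneous_separator S) u"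


subsection \<open>Modified SEALS\<close>

text \<open>
  The graph is the \<open>\<delta>\<close>-neighbour graph: all pairs of points at distance at most \<open>\<delta>\<close> are joined, and
  no others. The algorithm's tie-breaking rule presupposes this, and the converse direction is needed: a longer edge could lead to a point that is close to
  the current hyperplane but far from the examples of the opposite label, and the algorithm
  could then query that point forever.
\<close>

definition neighbour_graph :: "'a::euclidean_space set \<Rightarrow> real \<Rightarrow> ('a \<times> 'a) set \<Rightarrow> bool" where
  "neighbour_graph X \<delta> E \<longleftrightarrow>
     E \<subseteq> X \<times> X \<and> (\<forall>x\<in>X. \<forall>x'\<in>X. (x, x') \<in> E \<longleftrightarrow> norm (x - x') \<le> \<delta>)"

text \<open>
  A run of the algorithm with true normal vector \<open>w\<close>, for the rounds \<open>r = 1, 2, \<dots>\<close>. The index type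
  \<open>'i\<close> numbers the seed points. The choices of minimisers and separators are arbitrary, so
  that a run is a relation between the input and the sequences
    \<open>C i r\<close> (candidates), \<open>S r\<close> (labelled examples), \<open>H x r\<close> and \<open>g x r\<close> (hyperplane and margin),
    \<open>xb i r\<close> (candidate of least margin), \<open>xq i r\<close> (queried example) and \<open>wh r\<close> (estimate).
  The first estimate is \<open>wh 2\<close>, computed at the end of round 1.
\<close>

definition modified_seals_run ::
    "('a::euclidean_space \<times> 'a) set \<Rightarrow> real \<Rightarrow> 'a \<Rightarrow> ('a \<times> int) set \<Rightarrow> ('i \<Rightarrow> 'a) \<Rightarrow>
     ('i \<Rightarrow> nat \<Rightarrow> 'a set) \<Rightarrow> (nat \<Rightarrow> ('a \<times> int) set) \<Rightarrow>
     ('a \<Rightarrow> nat \<Rightarrow> 'a set) \<Rightarrow> ('a \<Rightarrow> nat \<Rightarrow> real) \<Rightarrow>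
     ('i \<Rightarrow> nat \<Rightarrow> 'a) \<Rightarrow> ('i \<Rightarrow> nat \<Rightarrow> 'a) \<Rightarrow> (nat \<Rightarrow> 'a) \<Rightarrow> bool" where
  "modified_seals_run E \<delta> w S1 x0 C S H g xb xq wh \<longleftrightarrow>
     S 1 = S1 \<and> (\<forall>i. C i 1 = {x0 i}) \<and>
     (\<forall>r\<ge>1.
        (\<forall>i. (\<forall>x\<in>C i r. max_margin_separator (with_label (S r) (- label w x)) {x} (H x r) (g x r)) \<and>
             is_arg_min (\<lambda>x. g x r) (\<lambda>x. x \<in> C i r) (xb i r) \<and>
             is_arg_min (\<lambda>x'. infdist x' (H (xb i r) r)) (\<lambda>x'. (xb i r, x') \<in> E) (xq i r) \<and>
             (infdist (xb i r) (H (xb i r) r) \<le> \<delta> \<longrightarrow>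
                xq i r = closest_point (H (xb i r) r) (xb i r)) \<and>
             C i (r + 1) = C i r \<union> {xq i r}) \<and>
        S (r + 1) = S r \<union> {(xq i r, label w (xq i r)) | i. True} \<and>
        homogeneous_max_margin (S (r + 1)) (wh (r + 1)))"

end

theory Submission
  imports Defs
begin

text \<open>
  For a seed index, let \<open>D\<close> be the distance from the current candidate to the convex hull of the
  examples of the opposite label. The maximum-margin hyperplane bisects this shortest segment, so
  the query moves along it by \<open>min \<delta> (D / 2)\<close>; whichever label is revealed, \<open>D\<close> drops by at least
  this amount. Hence \<open>D\<close> first decreases linearly and then geometrically, and the candidates never
  move farther from the seed than \<open>D\<close> has decreased.

  At the end every index yields a pair of nearby points (an example and a point of the opposite
  hull) that are separated by both \<open>w\<close> and the estimate \<open>v\<close>, hence a point \<open>z\<^sub>i\<close> orthogonal to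
  \<open>w + v\<close> and close to the hyperplane of \<open>w\<close>. As \<open>v - w\<close> is orthogonal to \<open>w + v\<close> too, it lies in
  the span of the \<open>z\<^sub>i\<close>, and the bound on the least singular value turns the smallness of all
  inner products of \<open>v - w\<close> with the \<open>z\<^sub>i\<close> into smallness of \<open>v - w\<close>.
\<close>

subsection \<open>The least singular value\<close>

text \<open>A minimiser of the quadratic form on the unit sphere of \<open>W\<close> is an
  eigenvector. The version for invariant subspaces is what later shows that the eigenspaces span the
  whole space.\<close>

lemma rayleigh_minimizer:
  fixes f :: "'a::euclidean_space \<Rightarrow> 'a"
  assumes "linear f" and sym: "\<And>x y. f x \<bullet> y = x \<bullet> f y"
    and W: "subspace W" and inv: "f ` W \<subseteq> W" and "\<not> W \<subseteq> {0}"
  obtains u where "u \<in> W" "norm u = 1" "f u = (u \<bullet> f u) *\<^sub>R u"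
    "\<forall>v\<in>W. (u \<bullet> f u) * (norm v)\<^sup>2 \<le> v \<bullet> f v"
proof -
  interpret linear f by fact
  have cont: "continuous_on A f" for A
    using \<open>linear f\<close> by (simp add: linear_continuous_on linear_conv_bounded_linear)
  have "compact (W \<inter> sphere 0 1)"
    using W by (simp add: closed_Int_compact closed_subspace)
  moreover have "W \<inter> sphere 0 1 \<noteq> {}"
  proof -
    obtain x where x: "x \<in> W" "x \<noteq> 0"
      using \<open>\<not> W \<subseteq> {0}\<close> by blast
    then have "x /\<^sub>R norm x \<in> W \<inter> sphere 0 1"
      using W by (simp add: subspace_scale)
    then show ?thesis
      by blast
  qed
  moreover have "continuous_on (W \<inter> sphere 0 1) (\<lambda>x. x \<bullet> f x)"
    by (intro continuous_intros cont)
  ultimately have "\<exists>u\<in>W \<inter> sphere 0 1. \<forall>x\<in>W \<inter> sphere 0 1. u \<bullet> f u \<le> x \<bullet> f x"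
    by (rule continuous_attains_inf)
  then obtain u where u: "u \<in> W" "norm u = 1"
    and min: "\<And>x. x \<in> W \<Longrightarrow> norm x = 1 \<Longrightarrow> u \<bullet> f u \<le> x \<bullet> f x"
    by auto
  define \<mu> where "\<mu> = u \<bullet> f u"
  have le: "\<mu> * (norm v)\<^sup>2 \<le> v \<bullet> f v" if "v \<in> W" for v
  proof (cases "v = 0")
    case False
    then have "\<mu> \<le> (v /\<^sub>R norm v) \<bullet> f (v /\<^sub>R norm v)"
      unfolding \<mu>_def using W that by (intro min) (simp_all add: subspace_scale)
    also have "\<dots> = v \<bullet> f v / (norm v)\<^sup>2"
      by (simp add: scale power2_eq_square field_simps)
    finally show ?thesis
      using False by (simp add: field_simps)
  qed (simp add: zero)
  \<comment> \<open>The residual of the eigenvalue equation: moving from \<open>u\<close> in the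
    direction \<open>- h\<close> would lower the Rayleigh quotient unless
    \<open>h = 0\<close>.\<close>
  define h where "h = f u - \<mu> *\<^sub>R u"
  define c where "c = h \<bullet> f h - \<mu> * (h \<bullet> h)"
  have "h \<in> W"
    unfolding h_def using u inv W by (auto intro!: subspace_diff subspace_scale)
  then have "c \<ge> 0"
    using le[of h] by (simp add: c_def power2_norm_eq_inner)
  have quad: "0 \<le> - 2 * s * (h \<bullet> h) + s\<^sup>2 * c" for s
  proof -
    have "u - s *\<^sub>R h \<in> W"
      using u \<open>h \<in> W\<close> W by (auto intro!: subspace_diff subspace_scale)
    from le[OF this] have "0 \<le> (u - s *\<^sub>R h) \<bullet> f (u - s *\<^sub>R h) - \<mu> * ((u - s *\<^sub>R h) \<bullet> (u - s *\<^sub>R h))"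
      by (simp add: power2_norm_eq_inner)
    also have "\<dots> = (u \<bullet> f u - \<mu> * (u \<bullet> u)) - 2 * s * (f u \<bullet> h - \<mu> * (u \<bullet> h)) + s\<^sup>2 * c"
      using sym[of u h]
      by (simp add: diff scale inner_diff_left inner_diff_right c_def power2_eq_square
          inner_commute algebra_simps)
    also have "u \<bullet> f u - \<mu> * (u \<bullet> u) = 0"
      using u by (simp add: \<mu>_def norm_eq_1)
    also have "f u \<bullet> h - \<mu> * (u \<bullet> h) = h \<bullet> h"
      by (simp add: h_def inner_diff_left)
    finally show ?thesis
      by simp
  qed
  \<comment> \<open>At \<open>s = k\<close> the quadratic in \<open>quad\<close> equals
    \<open>- k\<^sup>2 * (c + 2)\<close>; the summand 1 avoids a division by zero when
    \<open>c = 0\<close>.\<close>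
  define k where "k = (h \<bullet> h) / (c + 1)"
  have hh: "h \<bullet> h = k * (c + 1)"
    using \<open>c \<ge> 0\<close> by (simp add: k_def)
  have "k\<^sup>2 * (c + 2) \<le> 0"
    using quad[of k] unfolding hh by (simp add: power2_eq_square algebra_simps)
  then have "k\<^sup>2 \<le> 0"
    using \<open>c \<ge> 0\<close> by (simp add: mult_le_0_iff)
  then have "h = 0"
    using hh by simp
  then show thesis
    using that[of u] u le by (simp add: h_def \<mu>_def)
qed

section \<open>Eigenspaces of the Gram matrix and their dimensions\<close>

lemma dim_Union_orthogonal:
  fixes E :: "'b \<Rightarrow> 'a::euclidean_space set"
  assumes "finite T"
    and "\<And>s t x y. s \<in> T \<Longrightarrow> t \<in> T \<Longrightarrow> s \<noteq> t \<Longrightarrow> x \<in> E s \<Longrightarrow> y \<in> E t \<Longrightarrow> x \<bullet> y = 0"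
  shows "dim (\<Union>t\<in>T. E t) = (\<Sum>t\<in>T. dim (E t))"
  using assms
proof (induction T)
  case (insert t T)
  have "dim (E t \<union> (\<Union>t\<in>T. E t)) = dim (E t) + dim (\<Union>t\<in>T. E t)"
    using insert.hyps insert.prems[of t] by (intro dim_orthogonal_sum) blast
  moreover have "dim (\<Union>t\<in>T. E t) = (\<Sum>t\<in>T. dim (E t))"
    using insert.IH insert.prems by blast
  ultimately show ?case
    using insert.hyps by simp
qed simp

lemma gram_matrix_inner:
  fixes A :: "real^'m^'n"
  shows "((transpose A ** A) *v x) \<bullet> y = (A *v x) \<bullet> (A *v y)"
  by (simp add: dot_lmul_matrix flip: matrix_vector_mul_assoc)

text \<open>Eigenvectors of a symmetric matrix for distinct eigenvalues are orthogonal. The signs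
  matter because \<open>singular_space\<close> depends on \<open>s\<close> only through its
  square.\<close>

lemma singular_space_orthogonal:
  assumes "x \<in> singular_space A s" "y \<in> singular_space A t" "0 \<le> s" "0 \<le> t" "s \<noteq> t"
  shows "x \<bullet> y = 0"
proof -
  have "s\<^sup>2 * (x \<bullet> y) = t\<^sup>2 * (x \<bullet> y)"
    using assms(1,2) gram_matrix_inner[of A x y] gram_matrix_inner[of A y x]
    by (simp add: singular_space_def inner_commute)
  moreover have "s\<^sup>2 \<noteq> t\<^sup>2"
    using assms by simp
  ultimately show ?thesis
    by simp
qed

lemma dim_singular_space_pos:
  assumes "s \<in> singular_values A"
  shows "1 \<le> dim (singular_space A s)"
proof -
  have "\<not> singular_space A s \<subseteq> {0}"
    using assms by (auto simp: singular_values_def)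
  then show ?thesis
    using dim_eq_0[of "singular_space A s"] by linarith
qed

lemma dim_Union_singular_space:
  assumes "finite T" "T \<subseteq> singular_values A"
  shows "dim (\<Union>t\<in>T. singular_space A t) = (\<Sum>t\<in>T. dim (singular_space A t))"
  using assms
  by (intro dim_Union_orthogonal) (auto simp: singular_values_def intro: singular_space_orthogonal)

text \<open>Each singular value contributes at least one dimension to an orthogonal sum inside a
  space of dimension \<open>CARD('m)\<close>. Finiteness gives the \<open>Max\<close> and the sum in
  \<open>singular_value\<close> their meaning.\<close>

lemma finite_singular_values:
  fixes A :: "real^'m^'n"
  shows "finite (singular_values A)"
proof -
  have "card T \<le> CARD('m)" if T: "T \<subseteq> singular_values A" "finite T" for T
  proof -
    have "card T \<le> (\<Sum>t\<in>T. dim (singular_space A t))"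
      using T sum_mono[of T "\<lambda>_. 1" "\<lambda>t. dim (singular_space A t)"] dim_singular_space_pos
      by auto
    also have "\<dots> = dim (\<Union>t\<in>T. singular_space A t)"
      using T by (simp add: dim_Union_singular_space)
    also have "\<dots> \<le> CARD('m)"
      using dim_subset_UNIV[of "\<Union>t\<in>T. singular_space A t"] by simp
    finally show ?thesis .
  qed
  then show ?thesis
    using finite_if_finite_subsets_card_bdd by blast
qed

lemma singular_space_norm:
  fixes A :: "real^'m^'n"
  assumes "u \<in> singular_space A s" "0 \<le> s"
  shows "norm (A *v u) = s * norm u"
proof -
  have "(norm (A *v u))\<^sup>2 = (s * norm u)\<^sup>2"
    using assms gram_matrix_inner[of A u u]
    by (simp add: singular_space_def power2_norm_eq_inner power_mult_distrib)
  then show ?thesis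
    using assms by (simp add: power2_eq_iff_nonneg)
qed

text \<open>The quadratic form of the Gram matrix is the square of \<open>norm (A *v x)\<close>, so
  the eigenvalue found by minimising it is the square of \<open>norm (A *v u)\<close>.\<close>

lemma gram_rayleigh_minimizer:
  fixes A :: "real^'m^'n"
  assumes "subspace W" "\<And>x. x \<in> W \<Longrightarrow> (transpose A ** A) *v x \<in> W" "\<not> W \<subseteq> {0}"
  obtains u where "u \<in> W" "norm u = 1" "u \<in> singular_space A (norm (A *v u))"
    "\<forall>v\<in>W. norm (A *v u) * norm v \<le> norm (A *v v)"
proof -
  let ?f = "\<lambda>x. (transpose A ** A) *v x"
  have f: "x \<bullet> ?f x = (norm (A *v x))\<^sup>2" for x
    by (metis gram_matrix_inner inner_commute power2_norm_eq_inner)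
  have sym: "?f x \<bullet> y = x \<bullet> ?f y" for x y
    by (metis gram_matrix_inner inner_commute)
  have inv: "?f ` W \<subseteq> W"
    using assms(2) by blast
  obtain u where u: "u \<in> W" "norm u = 1" "?f u = (u \<bullet> ?f u) *\<^sub>R u"
    and le: "\<forall>v\<in>W. (u \<bullet> ?f u) * (norm v)\<^sup>2 \<le> v \<bullet> ?f v"
    by (rule rayleigh_minimizer[of ?f W, OF matrix_vector_mul_linear sym assms(1) inv assms(3)])
      (rule that)
  show thesis
  proof (rule that[of u])
    have "(norm (A *v u) * norm v)\<^sup>2 \<le> (norm (A *v v))\<^sup>2" if "v \<in> W" for v
      using le that unfolding f power_mult_distrib by blast
    then show "\<forall>v\<in>W. norm (A *v u) * norm v \<le> norm (A *v v)"
      using power2_le_imp_le norm_ge_zero by blast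
    show "u \<in> singular_space A (norm (A *v u))"
      using u(3) unfolding f singular_space_def by blast
  qed (use u in blast)+
qed

text \<open>The orthogonal complement \<open>W\<close> of all eigenspaces is invariant; if it were
  nonzero, it would contain an eigenvector, which would be orthogonal to itself.\<close>

lemma sum_dim_singular_space:
  fixes A :: "real^'m^'n"
  shows "(\<Sum>t\<in>singular_values A. dim (singular_space A t)) = CARD('m)"
proof -
  let ?U = "\<Union>t\<in>singular_values A. singular_space A t"
  define W where "W = {x. \<forall>y\<in>?U. orthogonal x y}"
  have "W \<subseteq> {0}"
  proof (rule ccontr)
    assume "\<not> W \<subseteq> {0}"
    have "subspace W"
      unfolding W_def by (auto simp: subspace_def orthogonal_def inner_add_left)
    have "(transpose A ** A) *v x \<in> W" if "x \<in> W" for x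
    proof -
      have "((transpose A ** A) *v x) \<bullet> y = 0"
        if y: "t \<in> singular_values A" "y \<in> singular_space A t" for y t
      proof -
        have "((transpose A ** A) *v x) \<bullet> y = x \<bullet> ((transpose A ** A) *v y)"
          by (metis gram_matrix_inner inner_commute)
        also have "\<dots> = t\<^sup>2 * (x \<bullet> y)"
          using y by (simp add: singular_space_def)
        also have "x \<bullet> y = 0"
          using \<open>x \<in> W\<close> y by (auto simp: W_def orthogonal_def)
        finally show ?thesis
          by simp
      qed
      then show ?thesis
        by (auto simp: W_def orthogonal_def)
    qed
    then obtain u where u: "u \<in> W" "norm u = 1" "u \<in> singular_space A (norm (A *v u))"
      by (rule gram_rayleigh_minimizer[OF \<open>subspace W\<close> _ \<open>\<not> W \<subseteq> {0}\<close>])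
    then have "norm (A *v u) \<in> singular_values A"
      by (auto simp: singular_values_def intro!: bexI[of _ u])
    with u have "orthogonal u u"
      by (auto simp: W_def)
    with u show False
      by (simp add: orthogonal_def norm_eq_1)
  qed
  have "x \<in> span ?U" for x
  proof (rule orthogonal_subspace_decomp_exists[of ?U x])
    fix y z
    assume yz: "y \<in> span ?U" "\<And>w. w \<in> span ?U \<Longrightarrow> orthogonal z w" "x = y + z"
    have "z \<in> W"
      using yz(2)[OF span_base] unfolding W_def by blast
    with \<open>W \<subseteq> {0}\<close> yz show "x \<in> span ?U"
      by auto
  qed
  then have "span ?U = UNIV"
    by auto
  then have "dim ?U = CARD('m)"
    using dim_span[of ?U] by (simp del: dim_span)
  then show ?thesis
    using dim_Union_singular_space[OF finite_singular_values order_refl] by metis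
qed

text \<open>Links the definition by multiplicities with the variational description: the
  multiplicities add up to \<open>CARD('m)\<close>, so the last singular value is the least
  one.\<close>

lemma singular_value_card_attained:
  fixes A :: "real^'m^'n"
  obtains u where "singular_value CARD('m) A = norm (A *v u)" "norm u = 1"
    "\<forall>v. norm (A *v u) * norm v \<le> norm (A *v v)"
proof -
  have "\<not> (UNIV :: (real^'m) set) \<subseteq> {0}"
  proof
    assume "(UNIV :: (real^'m) set) \<subseteq> {0}"
    then have "axis undefined 1 = (0 :: real^'m)"
      by blast
    then show False
      by (simp add: axis_eq_0_iff)
  qed
  then obtain u where u: "norm u = 1" "u \<in> singular_space A (norm (A *v u))"
    and "\<forall>v\<in>UNIV. norm (A *v u) * norm v \<le> norm (A *v v)"
    using gram_rayleigh_minimizer[OF subspace_UNIV UNIV_I, of A] by metis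
  then have min: "\<And>v. norm (A *v u) * norm v \<le> norm (A *v v)"
    by blast
  let ?s = "norm (A *v u)"
  let ?N = "{s \<in> singular_values A.
    CARD('m) \<le> (\<Sum>t\<in>{t \<in> singular_values A. s \<le> t}. dim (singular_space A t))}"
  have s: "?s \<in> singular_values A"
    using u by (auto simp: singular_values_def intro!: bexI[of _ u])
  have least: "?s \<le> t" if t: "t \<in> singular_values A" for t
  proof -
    obtain v where v: "v \<in> singular_space A t" "v \<noteq> 0" "0 \<le> t"
      using t by (auto simp: singular_values_def)
    then show ?thesis
      using min[of v] singular_space_norm[of v A t] by simp
  qed
  then have "{t \<in> singular_values A. ?s \<le> t} = singular_values A"
    by auto
  then have "?s \<in> ?N"
    using s by (simp add: sum_dim_singular_space)
  \<comment> \<open>A larger \<open>t\<close> omits the eigenspace of \<open>?s\<close> from its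
    count, which therefore falls below \<open>CARD('m)\<close>.\<close>
  moreover have "t \<le> ?s" if t: "t \<in> ?N" for t
  proof (rule ccontr)
    let ?T = "{t' \<in> singular_values A. t \<le> t'}"
    assume "\<not> t \<le> ?s"
    then have "?s \<notin> ?T"
      by simp
    moreover have fin: "finite ?T"
      using finite_singular_values[of A] by simp
    ultimately have "dim (singular_space A ?s) + (\<Sum>t\<in>?T. dim (singular_space A t)) =
        (\<Sum>t\<in>insert ?s ?T. dim (singular_space A t))"
      by simp
    also have "\<dots> \<le> (\<Sum>t\<in>singular_values A. dim (singular_space A t))"
      using s by (intro sum_mono2 finite_singular_values) auto
    also have "\<dots> = CARD('m)"
      by (rule sum_dim_singular_space)
    finally show False
      using t dim_singular_space_pos[OF s] by simp
  qed
  ultimately have "singular_value CARD('m) A = ?s"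
    unfolding singular_value_def using finite_singular_values[of A]
    by (intro Max_eqI) auto
  then show thesis
    using that u(1) min by blast
qed

lemma singular_value_card_nonneg:
  fixes A :: "real^'m^'n"
  shows "0 \<le> singular_value CARD('m) A"
  by (rule singular_value_card_attained[of A]) simp

lemma singular_value_card_le:
  fixes A :: "real^'m^'n"
  shows "singular_value CARD('m) A * norm u \<le> norm (A *v u)"
  by (rule singular_value_card_attained[of A]) simp

lemma matrix_of_columns_mult: "matrix_of_columns z *v u = (\<Sum>i\<in>UNIV. u $ i *\<^sub>R z i)"
  by (vector matrix_of_columns_def matrix_vector_mult_def) (simp add: mult.commute)

text \<open>The columns are independent and as many as the dimension of the hyperplane orthogonal to
  \<open>b\<close>, so \<open>v = ?A *v u\<close> for some \<open>u\<close>. Then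
  \<open>norm v\<close> squared is the inner product of \<open>u\<close> with the vector of all
  \<open>v \<bullet> z i\<close>, while \<open>\<sigma> * norm u \<le> norm v\<close>.\<close>

lemma norm_le_of_inner_columns:
  fixes z :: "'m::finite \<Rightarrow> real^'n"
  assumes card: "CARD('m) = CARD('n) - 1" and "b \<noteq> 0"
    and zb: "\<And>i. b \<bullet> z i = 0" and vb: "b \<bullet> v = 0"
    and "0 < \<sigma>" and \<sigma>: "\<sigma> \<le> singular_value CARD('m) (matrix_of_columns z)"
    and \<eta>: "\<And>i. \<bar>v \<bullet> z i\<bar> \<le> \<eta>"
  shows "\<sigma> * norm v \<le> sqrt (real CARD('m)) * \<eta>"
proof -
  let ?A = "matrix_of_columns z"
  have low: "\<sigma> * norm u \<le> norm (?A *v u)" for u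
    using singular_value_card_le[of ?A u] mult_right_mono[OF \<sigma>, of "norm u"] by simp
  have "inj ((*v) ?A)"
  proof (subst linear_injective_0[OF matrix_vector_mul_linear], intro allI impI)
    show "u = 0" if "?A *v u = 0" for u
      using low[of u] that \<open>0 < \<sigma>\<close> by (simp add: mult_le_0_iff)
  qed
  then have "dim (range ((*v) ?A)) = dim (UNIV :: (real^'m) set)"
    by (intro dim_image_eq matrix_vector_mul_linear) (simp add: inj_on_subset)
  then have dim: "dim (range ((*v) ?A)) = CARD('n) - 1"
    by (simp add: card)
  have "range ((*v) ?A) = {x. b \<bullet> x = 0}"
  proof (rule subspace_dim_equal)
    show "subspace (range ((*v) ?A))"
      by (intro linear_subspace_image matrix_vector_mul_linear subspace_UNIV)
    show "range ((*v) ?A) \<subseteq> {x. b \<bullet> x = 0}"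
      by (auto simp: matrix_of_columns_mult inner_sum_right zb)
    show "dim {x. b \<bullet> x = 0} \<le> dim (range ((*v) ?A))"
      using \<open>b \<noteq> 0\<close> by (simp add: dim dim_hyperplane)
  qed (rule subspace_hyperplane)
  then obtain u where u: "v = ?A *v u"
    using vb by blast
  let ?c = "\<chi> i. v \<bullet> z i"
  have "(norm ?c)\<^sup>2 = (\<Sum>i\<in>UNIV. (v \<bullet> z i)\<^sup>2)"
    unfolding power2_norm_eq_inner inner_vec_def[of "?c"] by (simp add: power2_eq_square)
  also have "\<dots> \<le> (\<Sum>i\<in>(UNIV :: 'm set). \<eta>\<^sup>2)"
    using \<eta> by (intro sum_mono) (metis abs_ge_zero power2_abs power_mono)
  also have "\<dots> = (sqrt (real CARD('m)) * \<eta>)\<^sup>2"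
    by (simp add: power_mult_distrib)
  finally have c2: "(norm ?c)\<^sup>2 \<le> (sqrt (real CARD('m)) * \<eta>)\<^sup>2" .
  have "0 \<le> \<eta>"
    using \<eta>[of undefined] by simp
  then have "0 \<le> sqrt (real CARD('m)) * \<eta>"
    by simp
  with c2 have c: "norm ?c \<le> sqrt (real CARD('m)) * \<eta>"
    by (rule power2_le_imp_le)
  have "norm v * norm v = v \<bullet> (?A *v u)"
    unfolding u[symmetric] by (simp add: power2_norm_eq_inner flip: power2_eq_square)
  also have "\<dots> = u \<bullet> ?c"
    unfolding matrix_of_columns_mult inner_sum_right inner_vec_def[of _ ?c] by simp
  also have "\<dots> \<le> norm u * norm ?c"
    by (rule norm_cauchy_schwarz)
  also have "\<dots> \<le> norm u * (sqrt (real CARD('m)) * \<eta>)"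
    using c by (intro mult_left_mono) auto
  finally have "\<sigma> * (norm v * norm v) \<le> \<sigma> * norm u * (sqrt (real CARD('m)) * \<eta>)"
    using \<open>0 < \<sigma>\<close> by (simp add: mult.assoc)
  also have "\<dots> \<le> norm v * (sqrt (real CARD('m)) * \<eta>)"
    using low[of u] order_trans[OF norm_ge_zero c] unfolding u by (intro mult_right_mono) auto
  finally have "norm v * (\<sigma> * norm v) \<le> norm v * (sqrt (real CARD('m)) * \<eta>)"
    by (simp add: mult_ac)
  then show ?thesis
    using order_trans[OF norm_ge_zero c] by (cases "v = 0") auto
qed

subsection \<open>Maximum-margin separators and queries\<close>

lemma hyperplane_foot:
  fixes a :: "'a::euclidean_space"
  assumes "a \<noteq> 0"
  shows infdist_hyperplane: "infdist z {x. a \<bullet> x = b} = \<bar>a \<bullet> z - b\<bar> / norm a"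
    and closest_point_hyperplane:
      "closest_point {x. a \<bullet> x = b} z = z - ((a \<bullet> z - b) / (a \<bullet> a)) *\<^sub>R a"
proof -
  let ?H = "{x. a \<bullet> x = b}" and ?c = "z - ((a \<bullet> z - b) / (a \<bullet> a)) *\<^sub>R a"
  have c: "?c \<in> ?H"
    using assms by (simp add: inner_diff_right)
  have dist: "dist z ?c = \<bar>a \<bullet> z - b\<bar> / norm a"
    by (simp add: dist_norm power2_eq_square flip: power2_norm_eq_inner)
  have le: "\<bar>a \<bullet> z - b\<bar> / norm a \<le> dist z h" if "h \<in> ?H" for h
  proof -
    have "\<bar>a \<bullet> (z - h)\<bar> \<le> norm a * norm (z - h)"
      by (rule Cauchy_Schwarz_ineq2)
    then show ?thesis
      using that assms by (simp add: inner_diff_right dist_norm field_simps)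
  qed
  have "?c = closest_point ?H z"
    using c le dist by (intro closest_point_unique convex_hyperplane closed_hyperplane) auto
  then show "closest_point ?H z = ?c" ..
  have "setdist {z} ?H = dist z (closest_point ?H z)"
    using c by (intro setdist_closest_point closed_hyperplane) blast
  then show "infdist z ?H = \<bar>a \<bullet> z - b\<bar> / norm a"
    unfolding infdist_eq_setdist \<open>?c = closest_point ?H z\<close>[symmetric] dist .
qed

lemma margin_le_infdist: "y \<in> A \<union> B \<Longrightarrow> margin A B H \<le> infdist y H"
  unfolding margin_def infdist_eq_setdist by (intro setdist_subset_left) auto

text \<open>The perpendicular bisector of the segment from \<open>x\<close> to \<open>p\<close> has
  margin \<open>dist x p / 2\<close>, because the hull lies beyond \<open>p\<close>. Conversely, a
  margin \<open>m\<close> keeps \<open>x\<close> and \<open>p\<close> at distance at least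
  \<open>m\<close> on opposite sides, so \<open>2 * m \<le> dist x p\<close>.\<close>

lemma max_margin_separator_point:
  fixes x :: "'a::euclidean_space"
  assumes "finite A" "A \<noteq> {}" "x \<notin> convex hull A" "max_margin_separator A {x} H m"
  defines "p \<equiv> closest_point (convex hull A) x"
  shows "m = dist x p / 2" and "H = {z. (x - p) \<bullet> z = (x - p) \<bullet> midpoint x p}"
proof -
  let ?a = "x - p" and ?b = "(x - p) \<bullet> midpoint x p"
  let ?H = "{z. ?a \<bullet> z = ?b}"
  have closed: "closed (convex hull A)"
    using assms(1) by (simp add: compact_imp_closed finite_imp_compact_convex_hull)
  have p: "p \<in> convex hull A"
    unfolding p_def using assms(2) closed hull_subset[of A convex] by (intro closest_point_in_set) auto
  then have pos: "norm ?a > 0"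
    using assms(3) by auto
  have ax: "?a \<bullet> x - ?b = (norm ?a)\<^sup>2 / 2"
    unfolding power2_norm_eq_inner by (simp add: midpoint_def inner_simps field_simps inner_commute)
  have aA: "?b - ?a \<bullet> y \<ge> (norm ?a)\<^sup>2 / 2" if "y \<in> A" for y
  proof -
    have "?a \<bullet> (y - p) \<le> 0"
      unfolding p_def using that closed by (intro closest_point_dot convex_convex_hull hull_inc)
    moreover have "?b - ?a \<bullet> p = (norm ?a)\<^sup>2 / 2"
      unfolding power2_norm_eq_inner by (simp add: midpoint_def inner_simps field_simps inner_commute)
    ultimately show ?thesis
      by (simp add: inner_diff_right)
  qed
  have "separating_hyperplane A {x} ?H"
    unfolding separating_hyperplane_def
  proof (intro exI conjI ballI)
    show "?a \<noteq> 0"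
      using pos by simp
    show "?a \<bullet> y \<le> ?b" if "y \<in> A" for y
      using aA[OF that] zero_le_power2[of "norm ?a"] by linarith
    show "?b \<le> ?a \<bullet> y" if "y \<in> {x}" for y
    proof -
      have "y = x"
        using that by simp
      moreover have "0 \<le> (norm ?a)\<^sup>2 / 2"
        by simp
      ultimately show ?thesis
        unfolding ax[symmetric] by simp
    qed
  qed rule
  moreover have "norm ?a / 2 \<le> margin A {x} ?H"
    unfolding margin_def
  proof (rule le_setdistI)
    show "?H \<noteq> {}"
      by blast
    show "norm ?a / 2 \<le> dist y h" if y: "y \<in> A \<union> {x}" and h: "h \<in> ?H" for y h
    proof -
      have "(norm ?a)\<^sup>2 / 2 \<le> \<bar>?a \<bullet> y - ?b\<bar>"
      proof (cases "y \<in> A")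
        case True
        from aA[OF this] show ?thesis
          by linarith
      next
        case False
        with y have "y = x"
          by simp
        then show ?thesis
          unfolding ax[symmetric] by simp
      qed
      then have "norm ?a / 2 \<le> infdist y ?H"
        using pos by (simp add: infdist_hyperplane field_simps power2_eq_square)
      also have "\<dots> \<le> dist y h"
        using h by (rule infdist_le)
      finally show ?thesis .
    qed
  qed simp
  ultimately have m_ge: "norm ?a / 2 \<le> m"
    using assms(4) unfolding max_margin_separator_def by (meson order_trans)
  obtain a b where a: "a \<noteq> 0" and H: "H = {z. a \<bullet> z = b}"
    and sep: "\<And>y. y \<in> A \<Longrightarrow> a \<bullet> y \<le> b" "b \<le> a \<bullet> x"
    using assms(4) by (auto simp: max_margin_separator_def separating_hyperplane_def)
  have m: "m * norm a \<le> \<bar>a \<bullet> y - b\<bar>" if "y \<in> A \<union> {x}" for y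
    using margin_le_infdist[OF that, of H] assms(4) a
    by (simp add: max_margin_separator_def H infdist_hyperplane field_simps)
  have "convex hull A \<subseteq> {y. a \<bullet> y \<le> b - m * norm a}"
    using m sep by (intro hull_minimal convex_halfspace_le) fastforce
  then have ap: "a \<bullet> p \<le> b - m * norm a"
    using p by blast
  have axb: "m * norm a \<le> a \<bullet> x - b"
    using m[of x] sep(2) by simp
  have cs: "a \<bullet> ?a \<le> norm a * norm ?a"
    by (rule norm_cauchy_schwarz)
  have "norm a * (2 * m) \<le> norm a * norm ?a"
    using ap axb cs by (simp add: inner_diff_right algebra_simps)
  then have m_eq: "m = norm ?a / 2"
    using m_ge a by simp
  then show "m = dist x p / 2"
    by (simp add: dist_norm)
  \<comment> \<open>With the optimal \<open>m\<close>, the inequalities \<open>ap\<close>,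
    \<open>axb\<close> and \<open>cs\<close> are all equalities; this fixes the offset and the
    direction of the normal.\<close>
  have "a \<bullet> ?a = norm a * norm ?a" and b: "b = a \<bullet> x - norm ?a * norm a / 2"
    using ap axb cs unfolding m_eq by (simp_all add: inner_diff_right algebra_simps)
  then have par: "norm a *\<^sub>R ?a = norm ?a *\<^sub>R a"
    by (simp add: norm_cauchy_schwarz_eq)
  have "a \<bullet> z = b \<longleftrightarrow> ?a \<bullet> z = ?b" for z
  proof -
    have ne: "norm ?a \<noteq> 0" "norm a \<noteq> 0"
      using pos a by auto
    have "norm ?a * (a \<bullet> z - b) = (norm ?a *\<^sub>R a) \<bullet> (z - x) + norm a * ((norm ?a)\<^sup>2 / 2)"
      by (simp add: b inner_diff_right power2_eq_square algebra_simps)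
    also have "\<dots> = norm a * (?a \<bullet> z - ?b)"
    proof -
      have "?a \<bullet> (z - x) + (norm ?a)\<^sup>2 / 2 = ?a \<bullet> z - ?b"
        unfolding ax[symmetric] inner_diff_right by simp
      then show ?thesis
        unfolding par[symmetric] inner_scaleR_left distrib_left[symmetric] by simp
    qed
    finally show ?thesis
      using ne by (metis eq_iff_diff_eq_0 mult_eq_0_iff)
  qed
  then show "H = ?H"
    by (simp add: H)
qed

text \<open>If the bisector \<open>H\<close> is within reach, the tie-breaking rule selects the
  midpoint. Otherwise the only neighbour of \<open>x\<close> closest to \<open>H\<close> is the
  point at distance \<open>\<delta>\<close> along the segment, which convexity places in
  \<open>X\<close>.\<close>

lemma query_towards_closest_point:
  fixes x :: "'a::euclidean_space"
  assumes "convex X" "\<delta> > 0" and graph: "neighbour_graph X \<delta> E" and "x \<in> X" "p \<in> X" "x \<noteq> p"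
    and H: "H = {z. (x - p) \<bullet> z = (x - p) \<bullet> midpoint x p}"
    and argmin: "is_arg_min (\<lambda>x'. infdist x' H) (\<lambda>x'. (x, x') \<in> E) q"
    and tie: "infdist x H \<le> \<delta> \<longrightarrow> q = closest_point H x"
  shows "dist x q = min \<delta> (dist x p / 2)" and "dist q p = dist x p - min \<delta> (dist x p / 2)"
proof -
  let ?a = "x - p" and ?D = "dist x p"
  have D: "?D > 0" "norm ?a = ?D" "?a \<bullet> ?a = ?D * ?D" "?a \<noteq> 0"
    using \<open>x \<noteq> p\<close> by (auto simp: dist_norm power2_eq_square simp flip: power2_norm_eq_inner)
  define t where "t = min \<delta> (?D / 2)"
  have ax: "?a \<bullet> x - ?a \<bullet> midpoint x p = ?D * ?D / 2"
    unfolding D(3)[symmetric] by (simp add: midpoint_def inner_simps field_simps inner_commute)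
  have inf: "infdist z H = \<bar>?a \<bullet> (z - x) + ?D * ?D / 2\<bar> / ?D" for z
  proof -
    have "?a \<bullet> z - ?a \<bullet> midpoint x p = ?a \<bullet> (z - x) + ?D * ?D / 2"
      using ax unfolding inner_diff_right by linarith
    then show ?thesis
      unfolding H infdist_hyperplane[OF D(4)] D(2) by simp
  qed
  have q: "q = x - (t / ?D) *\<^sub>R ?a"
  proof (cases "?D / 2 \<le> \<delta>")
    case True
    have "closest_point H x = x - (1 / 2) *\<^sub>R ?a"
      unfolding H closest_point_hyperplane[OF D(4)] ax D(3) using D(1) by simp
    moreover have "infdist x H \<le> \<delta>"
      unfolding inf using True D(1) by simp
    ultimately show ?thesis
      using tie True D(1) by (simp add: t_def)
  next
    case False
    let ?c = "x - (\<delta> / ?D) *\<^sub>R ?a"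
    have t: "t = \<delta>"
      using False by (simp add: t_def)
    have "?c = (1 - \<delta> / ?D) *\<^sub>R x + (\<delta> / ?D) *\<^sub>R p"
      by (simp add: algebra_simps)
    also have "\<dots> \<in> X"
      using \<open>convex X\<close> \<open>x \<in> X\<close> \<open>p \<in> X\<close> \<open>\<delta> > 0\<close> False D(1) by (intro convexD) (simp_all add: field_simps)
    finally have "?c \<in> X" .
    moreover have "norm (x - ?c) = \<delta>"
      using \<open>\<delta> > 0\<close> D by simp
    ultimately have "(x, ?c) \<in> E"
      using graph \<open>x \<in> X\<close> by (simp add: neighbour_graph_def)
    then have "infdist q H \<le> infdist ?c H" and q: "(x, q) \<in> E"
      using argmin by (auto simp: is_arg_min_linorder)
    moreover have "infdist ?c H = ?D / 2 - \<delta>"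
    proof -
      have "?a \<bullet> (?c - x) = - (\<delta> / ?D) * (?a \<bullet> ?a)"
      proof -
        have "?c - x = (- (\<delta> / ?D)) *\<^sub>R ?a"
          by simp
        then show ?thesis
          by (simp only: inner_scaleR_right)
      qed
      then have "?a \<bullet> (?c - x) + ?D * ?D / 2 = ?D * (?D / 2 - \<delta>)"
        using D(1) by (simp add: D(3) field_simps)
      then show ?thesis
        unfolding inf using False D(1) by (simp add: abs_mult)
    qed
    \<comment> \<open>As close to \<open>H\<close> as \<open>?c\<close>, the point \<open>q\<close>
      has advanced by at least \<open>\<delta>\<close> towards \<open>p\<close>. It is at most
      \<open>\<delta>\<close> away from \<open>x\<close>, so expanding the squared length of
      \<open>q - ?c\<close> gives at most \<open>\<delta>\<^sup>2 - 2 * \<delta>\<^sup>2 +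
      \<delta>\<^sup>2 = 0\<close>.\<close>
    ultimately have "\<bar>?a \<bullet> (q - x) + ?D * ?D / 2\<bar> \<le> ?D * (?D / 2 - \<delta>)"
      unfolding inf using D(1) by (simp add: field_simps)
    then have "?a \<bullet> (q - x) \<le> - (?D * \<delta>)"
      unfolding right_diff_distrib using abs_ge_self[of "?a \<bullet> (q - x) + ?D * ?D / 2"] by simp
    then have "(\<delta> / ?D) * (?a \<bullet> (q - x)) \<le> (\<delta> / ?D) * - (?D * \<delta>)"
      using D(1) \<open>\<delta> > 0\<close> by (intro mult_left_mono) auto
    also have "\<dots> = - (\<delta> * \<delta>)"
      using D(1) by simp
    finally have "(\<delta> / ?D) * (?a \<bullet> (q - x)) \<le> - (\<delta> * \<delta>)" .
    moreover have "norm (q - x) \<le> \<delta>"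
      using q graph by (auto simp: neighbour_graph_def norm_minus_commute)
    then have "(q - x) \<bullet> (q - x) \<le> \<delta> * \<delta>"
      unfolding power2_norm_eq_inner[symmetric] power2_eq_square using \<open>\<delta> > 0\<close>
      by (intro mult_mono) auto
    moreover have "(q - ?c) \<bullet> (q - ?c) =
        (q - x) \<bullet> (q - x) + 2 * ((\<delta> / ?D) * (?a \<bullet> (q - x))) + (\<delta> / ?D) * (\<delta> / ?D) * (?a \<bullet> ?a)"
    proof -
      have "(u + s *\<^sub>R v) \<bullet> (u + s *\<^sub>R v) = u \<bullet> u + 2 * (s * (v \<bullet> u)) + s * s * (v \<bullet> v)"
        for u v :: 'a and s
        by (simp add: inner_add_left inner_add_right inner_commute algebra_simps)
      moreover have "q - ?c = (q - x) + (\<delta> / ?D) *\<^sub>R ?a"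
        by simp
      ultimately show ?thesis
        by metis
    qed
    moreover have "(\<delta> / ?D) * (\<delta> / ?D) * (?a \<bullet> ?a) = \<delta> * \<delta>"
      using D by (simp add: field_simps)
    ultimately have "(q - ?c) \<bullet> (q - ?c) \<le> 0"
      by linarith
    then have "q - ?c = 0"
      by (metis inner_ge_zero inner_eq_zero_iff order_antisym)
    then show ?thesis
      unfolding t by (rule right_minus_eq[THEN iffD1])
  qed
  have t: "0 \<le> t" "t \<le> ?D"
    unfolding t_def using \<open>\<delta> > 0\<close> D(1) by linarith+
  have "dist x q = norm ((t / ?D) *\<^sub>R ?a)"
    unfolding q dist_norm by simp
  also have "\<dots> = t"
    unfolding norm_scaleR D(2) using D(1) t(1) by simp
  finally show "dist x q = min \<delta> (?D / 2)"
    by (simp only: t_def)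
  have "q - p = (1 - t / ?D) *\<^sub>R ?a"
    unfolding q by (simp add: algebra_simps)
  then have "dist q p = \<bar>1 - t / ?D\<bar> * ?D"
    unfolding dist_norm[of q] by (simp only: norm_scaleR D(2))
  also have "\<dots> = ?D - t"
    using D(1) t by (simp add: field_simps)
  finally show "dist q p = ?D - min \<delta> (?D / 2)"
    by (simp only: t_def)
qed

text \<open>One exponential covers both phases: \<open>s + 2 \<le> 2 * exp (s / 2)\<close> handles
  the linear one, with equality at \<open>s = 0\<close>, where the linear bound reaches
  \<open>2 * \<delta>\<close>; afterwards halving beats the factor
  \<open>exp (- 1 / 2)\<close>.\<close>

lemma exp_bound_of_decrement:
  fixes D :: "nat \<Rightarrow> real"
  assumes "\<delta> > 0" and step: "\<And>r. D (Suc r) \<le> D r - min \<delta> (D r / 2)"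
  shows "D r \<le> 2 * \<delta> * exp ((D 0 / \<delta> - 2 - real r) / 2)"
proof -
  define t where "t r = D 0 / \<delta> - 2 - real r" for r
  have lin: "\<delta> * (s + 2) \<le> 2 * \<delta> * exp (s / 2)" for s
  proof -
    have "s + 2 \<le> 2 * exp (s / 2)"
      using exp_ge_add_one_self[of "s / 2"] by linarith
    then have "\<delta> * (s + 2) \<le> \<delta> * (2 * exp (s / 2))"
      using \<open>\<delta> > 0\<close> by (intro mult_left_mono) auto
    then show ?thesis
      by simp
  qed
  \<comment> \<open>The linear bound is what carries the induction past the threshold \<open>2 * \<delta>\<close>.\<close>
  have "D r \<le> 2 * \<delta> * exp (t r / 2) \<and> (2 * \<delta> < D r \<longrightarrow> D r \<le> \<delta> * (t r + 2))"
  proof (induction r)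
    case 0
    have "D 0 = \<delta> * (t 0 + 2)"
      using \<open>\<delta> > 0\<close> by (simp add: t_def)
    then show ?case
      using lin[of "t 0"] by simp
  next
    case (Suc r)
    have t: "t (Suc r) = t r - 1"
      by (simp add: t_def)
    show ?case
    proof (cases "2 * \<delta> < D r")
      case True
      then have "D (Suc r) \<le> \<delta> * (t (Suc r) + 2)"
        using step[of r] Suc.IH unfolding t by (simp add: algebra_simps)
      then show ?thesis
        using lin[of "t (Suc r)"] by simp
    next
      case False
      then have D: "D (Suc r) \<le> D r / 2"
        using step[of r] by simp
      have "exp (1 / 2 :: real) \<le> 2"
      proof (rule power2_le_imp_le)
        have "(exp (1 / 2))\<^sup>2 = exp (1 :: real)"
          by (simp flip: exp_double)
        then show "(exp (1 / 2))\<^sup>2 \<le> (2 :: real)\<^sup>2"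
          using exp_le by simp
      qed simp
      then have "exp (t r / 2) \<le> 2 * exp (t (Suc r) / 2)"
        unfolding t diff_divide_distrib exp_diff by (simp add: field_simps)
      then have "\<delta> * exp (t r / 2) \<le> \<delta> * (2 * exp (t (Suc r) / 2))"
        using \<open>\<delta> > 0\<close> by simp
      then have "D (Suc r) \<le> 2 * \<delta> * exp (t (Suc r) / 2)" "D (Suc r) \<le> 2 * \<delta>"
        using D False Suc.IH \<open>\<delta> > 0\<close> by linarith+
      then show ?thesis
        by simp
    qed
  qed
  then show ?thesis
    by (simp add: t_def)
qed

subsection \<open>Runs of the algorithm\<close>

lemma label_cases: "label w x = 1 \<or> label w x = - 1"
  by (simp add: label_def)

text \<open>Finiteness of \<open>S1\<close> keeps every hull compact, so that closest points exist;
  \<open>opposite\<close> makes the initial distances meaningful, since \<open>infdist\<close> to an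
  empty set is 0 by convention.\<close>

locale modified_seals =
  fixes X :: "'a::euclidean_space set" and \<delta> :: real and E w S1
    and x0 :: "'i::finite \<Rightarrow> 'a" and C S H g xb xq wh
  assumes X: "convex X" and \<delta>: "\<delta> > 0" and graph: "neighbour_graph X \<delta> E"
    and S1: "finite S1" "S1 \<subseteq> X \<times> {- 1, 1}" "\<forall>(x, y)\<in>S1. y = label w x"
    and x0: "\<forall>i. (x0 i, label w (x0 i)) \<in> S1"
    and opposite: "\<forall>i. with_label S1 (- label w (x0 i)) \<noteq> {}"
    and run: "modified_seals_run E \<delta> w S1 x0 C S H g xb xq wh"
begin

abbreviation opp :: "nat \<Rightarrow> 'a \<Rightarrow> 'a set" where
  "opp r x \<equiv> convex hull (with_label (S r) (- label w x))"

text \<open>The potential of the argument: twice the least margin of a candidate for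
  \<open>i\<close> in round \<open>r\<close>.\<close>

abbreviation gap :: "'i \<Rightarrow> nat \<Rightarrow> real" where
  "gap i r \<equiv> infdist (xb i r) (opp r (xb i r))"

section \<open>Samples, candidates and their hulls\<close>

lemma init: "S 1 = S1" "C i 1 = {x0 i}"
  using run by (simp_all add: modified_seals_run_def)

lemma round:
  assumes "r \<ge> 1"
  shows "x \<in> C i r \<Longrightarrow> max_margin_separator (with_label (S r) (- label w x)) {x} (H x r) (g x r)"
    and "is_arg_min (\<lambda>x. g x r) (\<lambda>x. x \<in> C i r) (xb i r)"
    and "is_arg_min (\<lambda>x'. infdist x' (H (xb i r) r)) (\<lambda>x'. (xb i r, x') \<in> E) (xq i r)"
    and "infdist (xb i r) (H (xb i r) r) \<le> \<delta> \<longrightarrow> xq i r = closest_point (H (xb i r) r) (xb i r)"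
    and "C i (Suc r) = insert (xq i r) (C i r)"
    and "S (Suc r) = S r \<union> (\<lambda>i. (xq i r, label w (xq i r))) ` UNIV"
    and "homogeneous_max_margin (S (Suc r)) (wh (Suc r))"
  using run assms by (auto simp: modified_seals_run_def)

lemma xb_in: "r \<ge> 1 \<Longrightarrow> xb i r \<in> C i r"
  using round(2)[of r i] by (simp add: is_arg_min_def)

lemma xq_in: "r \<ge> 1 \<Longrightarrow> xq i r \<in> X"
  using round(3)[of r i] graph by (auto simp: is_arg_min_def neighbour_graph_def)

lemma S_props:
  assumes "r \<ge> 1"
  shows "finite (S r) \<and> fst ` S r \<subseteq> X \<and> (\<forall>(x, y)\<in>S r. y = label w x) \<and> S1 \<subseteq> S r"
  using assms
proof (induction rule: dec_induct)
  case base
  show ?case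
    unfolding init using S1 by auto
next
  case (step r)
  then show ?case
    using xq_in[of r] by (auto simp: round(6))
qed

lemma S_finite: "r \<ge> 1 \<Longrightarrow> finite (S r)"
  and S_X: "r \<ge> 1 \<Longrightarrow> (x, y) \<in> S r \<Longrightarrow> x \<in> X"
  and S_label: "r \<ge> 1 \<Longrightarrow> (x, y) \<in> S r \<Longrightarrow> y = label w x"
  and S1_subset: "r \<ge> 1 \<Longrightarrow> S1 \<subseteq> S r"
  using S_props[of r] by fastforce+

lemma C_S: "r \<ge> 1 \<Longrightarrow> x \<in> C i r \<Longrightarrow> (x, label w x) \<in> S r"
proof (induction r rule: dec_induct)
  case base
  then show ?case
    unfolding init using x0 by auto
next
  case (step r)
  then show ?case
    by (auto simp: round(5,6))
qed

lemma with_label_finite: "r \<ge> 1 \<Longrightarrow> finite (with_label (S r) y)"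
  using S_finite[of r] finite_subset[of "with_label (S r) y" "fst ` S r"]
  by (force simp: with_label_def)

lemma with_label_nonempty: "r \<ge> 1 \<Longrightarrow> with_label (S r) (label w x) \<noteq> {}"
  and with_label_opp_nonempty: "r \<ge> 1 \<Longrightarrow> with_label (S r) (- label w x) \<noteq> {}"
proof -
  have "with_label (S r) 1 \<noteq> {} \<and> with_label (S r) (- 1) \<noteq> {}" if "r \<ge> 1"
    using S1_subset[OF that] x0[rule_format, of undefined] opposite[rule_format, of undefined]
      label_cases[of w "x0 undefined"]
    unfolding with_label_def by auto
  then show "r \<ge> 1 \<Longrightarrow> with_label (S r) (label w x) \<noteq> {}"
    and "r \<ge> 1 \<Longrightarrow> with_label (S r) (- label w x) \<noteq> {}"
    using label_cases[of w x] by auto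
qed

lemma opp_X: "r \<ge> 1 \<Longrightarrow> opp r x \<subseteq> X"
  using X S_X[of r] by (intro hull_minimal) (auto simp: with_label_def)

lemma hull_pos: "r \<ge> 1 \<Longrightarrow> p \<in> convex hull (with_label (S r) 1) \<Longrightarrow> 0 \<le> w \<bullet> p"
proof -
  assume r: "r \<ge> 1" and p: "p \<in> convex hull (with_label (S r) 1)"
  have "convex hull (with_label (S r) 1) \<subseteq> {x. w \<bullet> x \<ge> 0}"
    by (intro hull_minimal convex_halfspace_ge)
      (auto simp: with_label_def label_def split: if_splits dest: S_label[OF r])
  then show ?thesis
    using p by auto
qed

text \<open>An open halfspace is convex, so strict negativity survives in the hull. This keeps the
  two hulls disjoint and later excludes the estimate \<open>- w\<close>.\<close>

lemma hull_neg: "r \<ge> 1 \<Longrightarrow> p \<in> convex hull (with_label (S r) (- 1)) \<Longrightarrow> w \<bullet> p < 0"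
proof -
  assume r: "r \<ge> 1" and p: "p \<in> convex hull (with_label (S r) (- 1))"
  have "with_label (S r) (- 1) \<subseteq> {x. w \<bullet> x < 0}"
    using S_label[OF r] by (fastforce simp: with_label_def label_def split: if_splits)
  then have "convex hull (with_label (S r) (- 1)) \<subseteq> {x. w \<bullet> x < 0}"
    by (intro hull_minimal convex_halfspace_lt)
  then show ?thesis
    using p by auto
qed

lemma not_in_opp: "r \<ge> 1 \<Longrightarrow> x \<notin> opp r x"
  using hull_pos[of r x] hull_neg[of r x] by (auto simp: label_def split: if_splits)

section \<open>Queries and the decrease of the gap\<close>

lemma opp_attained:
  fixes x :: 'a
  assumes "r \<ge> 1"
  defines "p \<equiv> closest_point (opp r x) x"
  shows "p \<in> opp r x" "infdist x (opp r x) = dist x p"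
proof -
  have "closed (opp r x)" "opp r x \<noteq> {}"
    using with_label_finite[OF assms(1)] with_label_opp_nonempty[OF assms(1)]
    by (auto simp: compact_imp_closed finite_imp_compact_convex_hull)
  then show "p \<in> opp r x" "infdist x (opp r x) = dist x p"
    unfolding p_def infdist_eq_setdist by (simp_all add: closest_point_in_set setdist_closest_point)
qed

lemma separator:
  fixes x :: 'a
  assumes "r \<ge> 1" "x \<in> C i r"
  defines "p \<equiv> closest_point (opp r x) x"
  shows "g x r = infdist x (opp r x) / 2" "H x r = {z. (x - p) \<bullet> z = (x - p) \<bullet> midpoint x p}"
  using max_margin_separator_point[OF with_label_finite with_label_opp_nonempty not_in_opp
      round(1)[OF assms(1,2)]] assms(1)
  by (simp_all add: p_def opp_attained(2))

text \<open>Margins are half the distances to the opposite hulls, so least margin means least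
  distance.\<close>

lemma gap_le:
  assumes "r \<ge> 1" "x \<in> C i r"
  shows "gap i r \<le> infdist x (opp r x)"
proof -
  have "g (xb i r) r \<le> g x r"
    using round(2)[OF assms(1), of i] assms(2) by (auto simp: is_arg_min_linorder)
  then show ?thesis
    using separator(1)[OF assms(1)] assms xb_in by (metis divide_le_cancel zero_less_numeral less_asym)
qed

text \<open>A query with the label of \<open>xb i r\<close> becomes a candidate nearer to the same
  \<open>?p\<close>. A query with the other label enters the opposite hull one step away from
  \<open>xb i r\<close>, and a step is at most half the gap.\<close>

lemma query_gap:
  assumes r: "r \<ge> 1"
  shows "dist (xb i r) (xq i r) = min \<delta> (gap i r / 2)"
    and "gap i (Suc r) \<le> gap i r - min \<delta> (gap i r / 2)"
proof -
  let ?x = "xb i r" and ?q = "xq i r"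
  let ?p = "closest_point (opp r ?x) ?x"
  have x: "?x \<in> C i r"
    using r by (rule xb_in)
  have p: "?p \<in> opp r ?x" "gap i r = dist ?x ?p"
    using opp_attained[OF r] by blast+
  have "?x \<noteq> ?p"
    using p(1) not_in_opp[OF r] by metis
  moreover have "?x \<in> X" "?p \<in> X"
    using S_X[OF r C_S[OF r x]] opp_X[OF r] p(1) by auto
  ultimately have d: "dist ?x ?q = min \<delta> (gap i r / 2)" "dist ?q ?p = gap i r - min \<delta> (gap i r / 2)"
    using query_towards_closest_point[OF X \<delta> graph _ _ _ separator(2)[OF r x] round(3,4)[OF r]]
    unfolding p(2) by blast+
  then show "dist ?x ?q = min \<delta> (gap i r / 2)"
    by blast
  have r': "Suc r \<ge> 1"
    by simp
  show "gap i (Suc r) \<le> gap i r - min \<delta> (gap i r / 2)"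
  proof (cases "label w ?q = label w ?x")
    case True
    have "?p \<in> opp (Suc r) ?x"
      using p(1) hull_mono[of "with_label (S r) (- label w ?x)" "with_label (S (Suc r)) (- label w ?x)"]
      unfolding with_label_def round(6)[OF r] by blast
    then have "infdist ?q (opp (Suc r) ?q) \<le> dist ?q ?p"
      unfolding True by (rule infdist_le)
    moreover have "gap i (Suc r) \<le> infdist ?q (opp (Suc r) ?q)"
      using round(5)[OF r, of i] by (intro gap_le) auto
    ultimately show ?thesis
      using d(2) by linarith
  next
    case False
    then have "label w ?q = - label w ?x"
      using label_cases[of w ?q] label_cases[of w ?x] by auto
    then have "?q \<in> with_label (S (Suc r)) (- label w ?x)"
      by (auto simp: with_label_def round(6)[OF r])
    then have "infdist ?x (opp (Suc r) ?x) \<le> dist ?x ?q"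
      by (intro infdist_le hull_inc)
    moreover have "gap i (Suc r) \<le> infdist ?x (opp (Suc r) ?x)"
      using x round(5)[OF r, of i] by (intro gap_le) auto
    ultimately show ?thesis
      using d(1) by linarith
  qed
qed

text \<open>Telescoping: a new candidate is displaced from \<open>xb i r\<close> by exactly the
  amount by which the gap is guaranteed to shrink.\<close>

lemma candidate_dist:
  assumes "r \<ge> 1" "x \<in> C i r"
  shows "dist x (x0 i) \<le> gap i 1 - gap i r"
  using assms
proof (induction r arbitrary: x rule: dec_induct)
  case base
  then show ?case
    unfolding init by simp
next
  case (step r)
  have r: "r \<ge> 1"
    using step.hyps by simp
  have dec: "gap i (Suc r) \<le> gap i r - min \<delta> (gap i r / 2)"
    by (rule query_gap(2)[OF r])
  have "x = xq i r \<or> x \<in> C i r"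
    using step.prems round(5)[OF r, of i] by auto
  then show ?case
  proof
    assume x: "x = xq i r"
    have "dist x (x0 i) \<le> dist (xb i r) (xq i r) + dist (xb i r) (x0 i)"
      unfolding x by (rule dist_triangle3)
    then show ?thesis
      using step.IH[OF xb_in[OF r]] dec query_gap(1)[OF r, of i] by linarith
  next
    assume "x \<in> C i r"
    moreover have "0 \<le> min \<delta> (gap i r / 2)"
      using \<delta> infdist_nonneg by simp
    ultimately show ?thesis
      using step.IH[of x] dec by linarith
  qed
qed

lemma gap_bound:
  "gap i (Suc r) \<le> 2 * \<delta> * exp ((gap i 1 / \<delta> - 2 - real r) / 2)"
  using exp_bound_of_decrement[of \<delta> "\<lambda>r. gap i (Suc r)" r] query_gap(2) \<delta> by simp

text \<open>The pair is \<open>xb i r\<close> and the nearest point of its opposite hull, ordered by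
  label so that the label of the candidate no longer matters.\<close>

lemma opposite_pair:
  assumes "r \<ge> 1"
  obtains n p where "n \<in> convex hull (with_label (S r) (- 1))"
    "p \<in> convex hull (with_label (S r) 1)" "dist n p = gap i r"
    "dist n (xb i r) \<le> gap i r" "dist p (xb i r) \<le> gap i r"
proof -
  let ?x = "xb i r"
  let ?p = "closest_point (opp r ?x) ?x"
  have p: "?p \<in> opp r ?x" "gap i r = dist ?x ?p"
    using opp_attained[OF assms] by blast+
  have x: "?x \<in> convex hull (with_label (S r) (label w ?x))"
    using C_S[OF assms xb_in[OF assms], of i] by (intro hull_inc) (simp add: with_label_def)
  show thesis
  proof (cases "label w ?x = 1")
    case True
    show thesis
      by (rule that[of ?p ?x]) (use p x in \<open>simp_all add: True dist_commute\<close>)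
  next
    case False
    then have "label w ?x = - 1"
      using label_cases[of w ?x] by simp
    then show thesis
      by (intro that[of ?x ?p]) (use p x in \<open>simp_all add: dist_commute\<close>)
  qed
qed

section \<open>The estimate and the bisector\<close>

lemma estimate_separates:
  assumes "r \<ge> 1"
  defines "v \<equiv> wh (Suc r)"
  shows "norm v = 1"
    and "p \<in> convex hull (with_label (S (Suc r)) 1) \<Longrightarrow> 0 \<le> v \<bullet> p"
    and "n \<in> convex hull (with_label (S (Suc r)) (- 1)) \<Longrightarrow> v \<bullet> n \<le> 0"
proof -
  have v: "homogeneous_separator (S (Suc r)) v"
    using round(7)[OF assms(1)] by (simp add: v_def homogeneous_max_margin_def is_arg_max_def)
  then show "norm v = 1"
    by (simp add: homogeneous_separator_def)
  have "convex hull (with_label (S (Suc r)) 1) \<subseteq> {x. v \<bullet> x \<ge> 0}"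
    using v by (intro hull_minimal convex_halfspace_ge) (auto simp: homogeneous_separator_def)
  then show "p \<in> convex hull (with_label (S (Suc r)) 1) \<Longrightarrow> 0 \<le> v \<bullet> p"
    by blast
  have "convex hull (with_label (S (Suc r)) (- 1)) \<subseteq> {x. v \<bullet> x \<le> 0}"
    using v by (intro hull_minimal convex_halfspace_le) (auto simp: homogeneous_separator_def)
  then show "n \<in> convex hull (with_label (S (Suc r)) (- 1)) \<Longrightarrow> v \<bullet> n \<le> 0"
    by blast
qed

text \<open>A negative example is strictly negative for \<open>w\<close> and not positive for the
  estimate, so the two cannot cancel. Hence the bisector is a genuine hyperplane.\<close>

lemma sum_normals_nonzero:
  assumes "r \<ge> 1"
  shows "w + wh (Suc r) \<noteq> 0"
proof
  assume 0: "w + wh (Suc r) = 0"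
  have r: "Suc r \<ge> 1"
    by simp
  obtain n where "n \<in> with_label (S (Suc r)) (- 1)"
    using with_label_nonempty[OF r] with_label_opp_nonempty[OF r] label_cases[of w]
    by (metis all_not_in_conv)
  then have n: "n \<in> convex hull (with_label (S (Suc r)) (- 1))"
    by (rule hull_inc)
  have "(w + wh (Suc r)) \<bullet> n < 0"
    using hull_neg[OF r n] estimate_separates(3)[OF assms n] by (simp add: inner_add_left)
  then show False
    using 0 by simp
qed

text \<open>
  Using a point on the bisector \<open>w + wh\<close> rather than on either hyperplane is what rules out
  an estimate close to \<open>- w\<close>: the difference \<open>wh - w\<close> is orthogonal to the bisector's normal.
\<close>

lemma bisector_point:
  assumes "r \<ge> 1"
  obtains z where "(w + wh (Suc r)) \<bullet> z = 0" "\<bar>w \<bullet> z\<bar> \<le> norm w * gap i (Suc r)"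
    "dist z (x0 i) \<le> gap i 1"
proof -
  let ?b = "w + wh (Suc r)"
  have r: "Suc r \<ge> 1"
    by simp
  obtain n p where n: "n \<in> convex hull (with_label (S (Suc r)) (- 1))"
    and p: "p \<in> convex hull (with_label (S (Suc r)) 1)" and np: "dist n p = gap i (Suc r)"
    and near: "dist n (xb i (Suc r)) \<le> gap i (Suc r)" "dist p (xb i (Suc r)) \<le> gap i (Suc r)"
    by (rule opposite_pair[OF r])
  have w: "w \<bullet> n < 0" "0 \<le> w \<bullet> p"
    using hull_neg[OF r n] hull_pos[OF r p] .
  \<comment> \<open>Both normals agree on the sides of \<open>n\<close> and \<open>p\<close>, hence
    so does their sum, and the segment must cross the bisector.\<close>
  have "?b \<bullet> n \<le> 0" "0 \<le> ?b \<bullet> p"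
    using w estimate_separates(2,3)[OF assms] n p by (auto simp: inner_add_left intro: add_nonpos_nonpos)
  then have "\<exists>z\<in>closed_segment n p. ?b \<bullet> z = 0"
    by (intro connected_ivt_hyperplane[of _ n p]) auto
  then obtain z where z: "z \<in> closed_segment n p" and bz: "?b \<bullet> z = 0"
    by blast
  \<comment> \<open>\<open>z\<close> is within the current gap of \<open>xb i (Suc r)\<close>, which
    is within \<open>gap i 1 - gap i (Suc r)\<close> of the seed; the current gap cancels.\<close>
  have "closed_segment n p \<subseteq> cball (xb i (Suc r)) (gap i (Suc r))"
    using near by (intro closed_segment_subset convex_cball) (auto simp: dist_commute)
  then have "dist z (x0 i) \<le> gap i (Suc r) + dist (xb i (Suc r)) (x0 i)"
    using z dist_triangle[of z "x0 i" "xb i (Suc r)"] by (fastforce simp: dist_commute)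
  then have "dist z (x0 i) \<le> gap i 1"
    using candidate_dist[OF r xb_in[OF r], of i] by linarith
  moreover have "\<bar>w \<bullet> z\<bar> \<le> norm w * gap i (Suc r)"
  proof -
    have "closed_segment n p \<subseteq> {x. w \<bullet> x \<ge> w \<bullet> n} \<inter> {x. w \<bullet> x \<le> w \<bullet> p}"
      using w by (intro closed_segment_subset convex_Int convex_halfspace_ge convex_halfspace_le) auto
    then have "w \<bullet> n \<le> w \<bullet> z" "w \<bullet> z \<le> w \<bullet> p"
      using z by auto
    then have "\<bar>w \<bullet> z\<bar> \<le> w \<bullet> p - w \<bullet> n"
      using w by linarith
    also have "\<dots> \<le> norm w * norm (p - n)"
      unfolding inner_diff_right[symmetric] by (rule norm_cauchy_schwarz)
    finally show ?thesis
      using np by (simp add: dist_norm norm_minus_commute)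
  qed
  ultimately show thesis
    using bz that by blast
qed

end

theorem theorem2:
  fixes X :: "(real^'n) set" and w :: "real^'n" and \<delta> \<epsilon> \<sigma> :: real
    and E :: "((real^'n) \<times> (real^'n)) set"
    and S1 :: "((real^'n) \<times> int) set"
    and x0 :: "'m::finite \<Rightarrow> real^'n"
    and \<gamma> :: "'m \<Rightarrow> real" and Z :: "'m \<Rightarrow> (real^'n) set"
    and C :: "'m \<Rightarrow> nat \<Rightarrow> (real^'n) set" and S :: "nat \<Rightarrow> ((real^'n) \<times> int) set"
    and H :: "real^'n \<Rightarrow> nat \<Rightarrow> (real^'n) set" and g :: "real^'n \<Rightarrow> nat \<Rightarrow> real"
    and xb xq :: "'m \<Rightarrow> nat \<Rightarrow> real^'n" and wh :: "nat \<Rightarrow> real^'n"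
    and q :: nat
  assumes "CARD('m) = CARD('n) - 1"
    and "convex X" and "norm w = 1" and "\<delta> > 0" and "\<epsilon> > 0"
    and "neighbour_graph X \<delta> E"
    and "finite S1" and "S1 \<subseteq> X \<times> {- 1, 1}" and "\<forall>(x, y)\<in>S1. y = label w x"
    and "\<forall>i. (x0 i, label w (x0 i)) \<in> S1"
    and "\<forall>i. with_label S1 (- label w (x0 i)) \<noteq> {}"
    and "\<forall>i. \<gamma> i = infdist (x0 i) (convex hull (with_label S1 (- label w (x0 i))))"
    and "\<forall>i. Z i = {z. norm (z - x0 i) \<le> \<gamma> i + 2 * \<delta> + \<epsilon> \<and> infdist z {x. x \<bullet> w = 0} \<le> \<epsilon>}"
    and "\<sigma> = (INF z\<in>{z. \<forall>i. z i \<in> Z i}. singular_value (CARD('n) - 1) (matrix_of_columns z))"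
    and "\<sigma> > 0"
    and "modified_seals_run E \<delta> w S1 x0 C S H g xb xq wh"
    and "q \<ge> CARD('n) - 1"
    and "real q \<ge> (MAX i. real CARD('n) * (\<gamma> i / \<delta> + 2 * ln (2 * real CARD('n) * \<delta> / (\<epsilon> * min \<sigma> 1))))"
  shows "norm (wh (q div (CARD('n) - 1) + 1) - w) \<le> \<epsilon>"
proof -
  interpret modified_seals X \<delta> E w S1 x0 C S H g xb xq wh
    by unfold_locales (use assms in blast)+
  let ?d = "real CARD('n)" and ?m = "real CARD('m)"
  \<comment> \<open>The number of completed rounds: each round makes one query per seed index, and
    an incomplete last round is ignored.\<close>
  define R where "R = q div CARD('m)"
  \<comment> \<open>The target for the gaps. The factor \<open>min \<sigma> 1\<close> serves both
    the final division by \<open>\<sigma>\<close> and the bound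
    \<open>\<eta> \<le> \<epsilon>\<close> for membership in \<open>Z i\<close>; dividing by
    \<open>?d\<close> absorbs \<open>2 * sqrt ?m\<close>.\<close>
  define \<eta> where "\<eta> = \<epsilon> * min \<sigma> 1 / ?d"
  have d: "?d = ?m + 1" "?m \<ge> 1"
    using assms(1) zero_less_card_finite[where 'a = 'm] by linarith+
  have \<gamma>: "gap i 1 = \<gamma> i" for i
    using xb_in[of 1 i] assms(12) unfolding init by simp
  have R: "R \<ge> 1"
    using assms(1,17) zero_less_card_finite[where 'a = 'm] by (simp add: R_def div_greater_zero_iff Suc_leI)
  \<comment> \<open>Rounding down loses less than one round; the offset \<open>- 2\<close> in
    \<open>gap_bound\<close> makes up for it.\<close>
  have "q < (R + 1) * CARD('m)"
    unfolding R_def using dividend_less_div_times[of "CARD('m)" q] by (simp add: mult.commute)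
  then have "real q < (real R + 1) * ?m"
    by (metis of_nat_less_iff of_nat_mult of_nat_add of_nat_1)
  also have "\<dots> \<le> (real R + 1) * ?d"
    using d by (intro mult_left_mono) auto
  finally have q: "real q < (real R + 1) * ?d" .
  have \<eta>: "0 < \<eta>"
    using assms(5,15) by (simp add: \<eta>_def)
  have gap: "gap i (Suc R) \<le> \<eta>" for i
  proof -
    have "?d * (\<gamma> i / \<delta> + 2 * ln (2 * \<delta> / \<eta>)) \<le>
        (MAX i. ?d * (\<gamma> i / \<delta> + 2 * ln (2 * ?d * \<delta> / (\<epsilon> * min \<sigma> 1))))"
      by (intro Max_ge) (auto simp: \<eta>_def mult_ac)
    also have "\<dots> < ?d * (real R + 1)"
      by (rule order_le_less_trans[OF assms(18)]) (use q in \<open>simp add: mult.commute\<close>)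
    finally have "\<gamma> i / \<delta> + 2 * ln (2 * \<delta> / \<eta>) < real R + 1"
      by simp
    then have "(gap i 1 / \<delta> - 2 - real R) / 2 \<le> - ln (2 * \<delta> / \<eta>)"
      unfolding \<gamma> by simp
    then have "exp ((gap i 1 / \<delta> - 2 - real R) / 2) \<le> exp (- ln (2 * \<delta> / \<eta>))"
      by simp
    also have "\<dots> = \<eta> / (2 * \<delta>)"
      using \<open>\<delta> > 0\<close> \<eta> by (simp add: exp_minus field_simps)
    finally have "2 * \<delta> * exp ((gap i 1 / \<delta> - 2 - real R) / 2) \<le> 2 * \<delta> * (\<eta> / (2 * \<delta>))"
      using \<open>\<delta> > 0\<close> by (intro mult_left_mono) auto
    then show ?thesis
      using gap_bound[of i R] \<open>\<delta> > 0\<close> by simp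
  qed
  let ?b = "w + wh (Suc R)" and ?v = "wh (Suc R) - w"
  have "\<exists>z. ?b \<bullet> z = 0 \<and> \<bar>w \<bullet> z\<bar> \<le> \<eta> \<and> dist z (x0 i) \<le> \<gamma> i" for i
  proof -
    obtain z where "?b \<bullet> z = 0" "\<bar>w \<bullet> z\<bar> \<le> norm w * gap i (Suc R)" "dist z (x0 i) \<le> gap i 1"
      by (rule bisector_point[OF R])
    then show ?thesis
      using gap[of i] \<gamma>[of i] \<open>norm w = 1\<close> by (intro exI[of _ z]) auto
  qed
  then obtain z where z: "\<And>i. ?b \<bullet> z i = 0" "\<And>i. \<bar>w \<bullet> z i\<bar> \<le> \<eta>" "\<And>i. dist (z i) (x0 i) \<le> \<gamma> i"
    by metis
  have "\<eta> \<le> \<epsilon>"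
  proof -
    have "\<epsilon> * min \<sigma> 1 \<le> \<epsilon> * ?d"
      using \<open>\<epsilon> > 0\<close> d by (intro mult_left_mono) auto
    then show ?thesis
      using d by (simp add: \<eta>_def field_simps)
  qed
  have "z i \<in> Z i" for i
  proof -
    have "w \<noteq> 0"
      using \<open>norm w = 1\<close> by auto
    then have "infdist (z i) {x. x \<bullet> w = 0} = \<bar>w \<bullet> z i\<bar>"
      using infdist_hyperplane[of w "z i" 0] \<open>norm w = 1\<close> by (simp add: inner_commute)
    then show ?thesis
      using z(2)[of i] z(3)[of i] assms(4,5,13) \<open>\<eta> \<le> \<epsilon>\<close> by (simp add: dist_norm)
  qed
  then have \<sigma>: "\<sigma> \<le> singular_value CARD('m) (matrix_of_columns z)"
    unfolding assms(14) assms(1)[symmetric]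
    by (intro cINF_lower bdd_belowI2[where m = 0] singular_value_card_nonneg) auto
  have "\<bar>?v \<bullet> z i\<bar> \<le> 2 * \<eta>" for i
  proof -
    \<comment> \<open>On the bisector \<open>w\<close> and the estimate take opposite values, so
      controlling \<open>w \<bullet> z i\<close> controls the difference.\<close>
    have "?v \<bullet> z i = - 2 * (w \<bullet> z i)"
      using z(1)[of i] by (simp add: inner_add_left inner_diff_left)
    then show ?thesis
      using z(2)[of i] by (simp add: abs_mult)
  qed
  moreover have "?b \<bullet> ?v = 0"
    using estimate_separates(1)[OF R] \<open>norm w = 1\<close> inner_commute[of w "wh (Suc R)"]
    unfolding inner_add_left inner_diff_right norm_eq_1 by linarith
  ultimately have "\<sigma> * norm ?v \<le> sqrt ?m * (2 * \<eta>)"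
    by (intro norm_le_of_inner_columns[OF assms(1) sum_normals_nonzero[OF R] z(1) _ \<open>\<sigma> > 0\<close> \<sigma>])
  also have "\<dots> \<le> ?d * \<eta>"
  proof -
    \<comment> \<open>The arithmetic-geometric mean inequality for \<open>?m\<close> and 1, whose
      sum is the dimension.\<close>
    have "0 \<le> (sqrt ?m - 1)\<^sup>2"
      by simp
    then have "2 * sqrt ?m \<le> ?d"
      unfolding d(1) by (simp add: power2_diff)
    then show ?thesis
      using \<eta> mult_right_mono[of "2 * sqrt ?m" ?d \<eta>] by (simp add: mult_ac)
  qed
  also have "\<dots> = \<epsilon> * min \<sigma> 1"
    by (simp add: \<eta>_def)
  also have "\<dots> \<le> \<sigma> * \<epsilon>"
    using \<open>\<epsilon> > 0\<close> by (simp add: mult.commute)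
  finally have "norm ?v \<le> \<epsilon>"
    using \<open>\<sigma> > 0\<close> by simp
  then show ?thesis
    using assms(1) by (simp add: R_def)
qed

end
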